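(* Let $0<|q|<1$ and let $a,b,c,d$ be complex numbers with $c,d\neq -aq^{-m},-bq^{-n}$ for all integers $n,m\ge 0$ and $0<|d|<|b|$. Define $$\rho(a,b;c,d)=\left(1+\frac{1}{b}\right)\sum_{k=0}^{\infty}\frac{(c,-aq/d;q)_k}{(-aq;q)_k(-c/b;q)_{k+1}}\left(-\frac{d}{b}\right)^k.$$ Then $$\rho(a,b;c,d)=\sum_{k=0}^{\infty}q^{\binom{k}{2}}\left(1-\frac{aq^{2k+1}}{b}\right)\frac{(-1/b;q)_{k+1}(-aq/c,-aq/d;q)_k}{(-aq;q)_k(-c/b,-d/b;q)_{k+1}}\left(\frac{cd}{b}\right)^k$$ and $$\rho(a,b;c,d)=\left(1+\frac{1}{b}\right)\sum_{k=0}^{\infty}(-1)^kq^{\binom{k+1}{2}}\frac{(1+cdq^{2k}/b)(c,d,cd/(ab);q)_k}{(-aq;q)_k(-c/b,-d/b;q)_{k+1}}\left(\frac{a}{b}\right)^k.$$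
   Context: For complex $x$ and integer $n\ge 0$: $(x;q)_\infty=\prod_{j=0}^{\infty}(1-xq^j)$, $(x;q)_n=(x;q)_\infty/(xq^n;q)_\infty$, and $(x_1,\dots,x_m;q)_n=(x_1;q)_n\cdots(x_m;q)_n$. *)

theory Defs
  imports "HOL-Analysis.Analysis"
begin

definition qpoch_inf :: "complex \<Rightarrow> complex \<Rightarrow> complex" where
  "qpoch_inf x q = (\<Prod>j. 1 - x * q ^ j)"

text \<open>
  The quotient \<open>(x;q)\<^sub>\<infinity> / (xq\<^sup>n;q)\<^sub>\<infinity>\<close> has the form 0/0 when \<open>x = q\<^bsup>-m\<^esup>\<close> with \<open>m \<ge> n\<close>.
  The finite product is its value at all other \<open>x\<close> (lemma \<open>qpoch_eq_quotient\<close> below) and its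
  continuous extension to these.
\<close>

definition qpoch :: "complex \<Rightarrow> complex \<Rightarrow> nat \<Rightarrow> complex" where
  "qpoch x q n = (\<Prod>j<n. 1 - x * q ^ j)"

lemma qpoch_mult_qpoch_inf:
  assumes "norm q < 1"
  shows "qpoch x q n * qpoch_inf (x * q ^ n) q = qpoch_inf x q"
proof -
  have conv: "convergent_prod (\<lambda>j. 1 - y * q ^ j)" for y
  proof -
    have "summable (\<lambda>j. norm (- (y * q ^ j)))"
      using assms by (simp add: norm_mult norm_power summable_mult summable_geometric)
    then have "abs_convergent_prod (\<lambda>j. 1 + - (y * q ^ j))"
      by (simp add: abs_convergent_prod_conv_summable)
    then show ?thesis
      using abs_convergent_prod_imp_convergent_prod by force
  qed
  have lim: "(\<lambda>m. \<Prod>j\<le>m. 1 - y * q ^ j) \<longlonglongrightarrow> qpoch_inf y q" for y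
    unfolding qpoch_inf_def by (rule convergent_prod_LIMSEQ[OF conv])
  have split': "(\<Prod>j<m + n. 1 - x * q ^ j) = qpoch x q n * (\<Prod>j<m. 1 - x * q ^ n * q ^ j)" for m
    by (induction m) (simp_all add: qpoch_def power_add mult_ac)
  have split: "(\<Prod>j\<le>m + n. 1 - x * q ^ j) = qpoch x q n * (\<Prod>j\<le>m. 1 - x * q ^ n * q ^ j)" for m
    using split'[of "Suc m"] by (simp only: lessThan_Suc_atMost add_Suc)
  have "(\<lambda>m. \<Prod>j\<le>m + n. 1 - x * q ^ j) \<longlonglongrightarrow> qpoch x q n * qpoch_inf (x * q ^ n) q"
    unfolding split by (intro tendsto_intros lim)
  moreover have "(\<lambda>m. \<Prod>j\<le>m + n. 1 - x * q ^ j) \<longlonglongrightarrow> qpoch_inf x q"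
    using LIMSEQ_ignore_initial_segment[OF lim] .
  ultimately show ?thesis
    by (rule LIMSEQ_unique)
qed

lemma qpoch_eq_quotient:
  assumes "norm q < 1" and "qpoch_inf (x * q ^ n) q \<noteq> 0"
  shows "qpoch x q n = qpoch_inf x q / qpoch_inf (x * q ^ n) q"
  using qpoch_mult_qpoch_inf[OF assms(1)] assms(2) by (simp add: field_simps)

definition rho_term :: "complex \<Rightarrow> complex \<Rightarrow> complex \<Rightarrow> complex \<Rightarrow> complex \<Rightarrow> nat \<Rightarrow> complex" where
  "rho_term q a b c d k =
     qpoch c q k * qpoch (- a * q / d) q k / (qpoch (- a * q) q k * qpoch (- c / b) q (k + 1))
       * (- d / b) ^ k"

definition rho :: "complex \<Rightarrow> complex \<Rightarrow> complex \<Rightarrow> complex \<Rightarrow> complex \<Rightarrow> complex" where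
  "rho q a b c d = (1 + 1 / b) * (\<Sum>k. rho_term q a b c d k)"

definition rho_term2 :: "complex \<Rightarrow> complex \<Rightarrow> complex \<Rightarrow> complex \<Rightarrow> complex \<Rightarrow> nat \<Rightarrow> complex" where
  "rho_term2 q a b c d k =
     q ^ (k choose 2) * (1 - a * q ^ (2 * k + 1) / b)
       * (qpoch (- 1 / b) q (k + 1) * (qpoch (- a * q / c) q k * qpoch (- a * q / d) q k)
          / (qpoch (- a * q) q k * (qpoch (- c / b) q (k + 1) * qpoch (- d / b) q (k + 1))))
       * (c * d / b) ^ k"

definition rho_term3 :: "complex \<Rightarrow> complex \<Rightarrow> complex \<Rightarrow> complex \<Rightarrow> complex \<Rightarrow> nat \<Rightarrow> complex" where
  "rho_term3 q a b c d k =
     (- 1) ^ k * q ^ ((k + 1) choose 2)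
       * ((1 + c * d * q ^ (2 * k) / b)
            * (qpoch c q k * qpoch d q k * qpoch (c * d / (a * b)) q k)
          / (qpoch (- a * q) q k * (qpoch (- c / b) q (k + 1) * qpoch (- d / b) q (k + 1))))
       * (a / b) ^ k"

end

theory Submission
  imports Defs
begin

text \<open>
  Write \<open>S(a,b,c,d)\<close> for the sum of the terms \<open>t\<^sub>k\<close> defining \<open>\<rho>\<close> without the factor \<open>1 + 1/b\<close>.
  Telescoping \<open>r(q\<^sup>k) t\<^sub>k\<close>, with \<open>r(u) = (aqu - b)/(b + d)\<close> and \<open>r(u) = -(b + cdu)/(b + d)\<close>
  respectively, yields two inhomogeneous first-order recurrences: one expresses \<open>S(a,b,c,d)\<close> by
  \<open>S(aq,b/q,c,d)\<close>, the other by \<open>S(aq,b,cq,dq)\<close>. Iterating the first gives the second series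
  for \<open>\<rho>\<close>, iterating the other gives the third; the remainders vanish because
  the shifted sums stay bounded while the coefficients of the recurrences tend to zero.
\<close>

section \<open>Finite \<open>q\<close>-shifted factorials\<close>

lemma qpoch_0 [simp]: "qpoch x q 0 = 1"
  by (simp add: qpoch_def)

lemma qpoch_Suc: "qpoch x q (Suc k) = qpoch x q k * (1 - x * q ^ k)"
  by (simp add: qpoch_def)

lemma qpoch_add: "qpoch x q (n + k) = qpoch x q n * qpoch (x * q ^ n) q k"
  by (induction k) (simp_all add: qpoch_Suc power_add mult_ac)

lemma qpoch_shift: "(1 - x) * qpoch (x * q) q k = qpoch x q k * (1 - x * q ^ k)"
  using qpoch_add [of x q 1 k] by (simp add: qpoch_Suc)

lemma qpoch_nonzero:
  assumes "\<And>m. x * q ^ m \<noteq> 1"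
  shows "qpoch x q k \<noteq> 0"
  using assms by (auto simp: qpoch_def)

text \<open>Each factor is at most exp (X |q|^j), and the exponents form a geometric series. The
  bound depends on x only through X and not on k, so it serves all shifted parameters at
  once.\<close>

lemma norm_qpoch_le:
  assumes "norm q < 1" "norm x \<le> X"
  shows "norm (qpoch x q k) \<le> exp (X / (1 - norm q))"
proof -
  have X: "0 \<le> X"
    using assms(2) norm_ge_zero order_trans by blast
  have "norm (qpoch x q k) \<le> (\<Prod>j<k. exp (X * norm q ^ j))"
    unfolding qpoch_def prod_norm [symmetric]
  proof (intro prod_mono conjI norm_ge_zero)
    fix j
    have "norm (1 - x * q ^ j) \<le> 1 + norm x * norm q ^ j"
      by (metis norm_mult norm_one norm_power norm_triangle_ineq4)
    also have "\<dots> \<le> 1 + X * norm q ^ j"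
      using assms by (simp add: mult_right_mono)
    also have "\<dots> \<le> exp (X * norm q ^ j)"
      by simp
    finally show "norm (1 - x * q ^ j) \<le> exp (X * norm q ^ j)" .
  qed
  also have "\<dots> = exp (X * (\<Sum>j<k. norm q ^ j))"
    by (simp add: exp_sum sum_distrib_left)
  also have "\<dots> \<le> exp (X * (1 / (1 - norm q)))"
  proof -
    have "(\<Sum>j<k. norm q ^ j) \<le> (\<Sum>j. norm q ^ j)"
      using assms by (intro sum_le_suminf summable_geometric) auto
    also have "\<dots> = 1 / (1 - norm q)"
      using assms by (simp add: suminf_geometric)
    finally show ?thesis
      using X by (simp only: exp_le_cancel_iff) (rule mult_left_mono)
  qed
  finally show ?thesis
    by simp
qed

text \<open>The infinite product converges absolutely and has no vanishing factor, so its value is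
  nonzero. Hence the reciprocals of the partial products converge too, and a convergent sequence is
  bounded.\<close>

lemma inverse_qpoch_bounded:
  assumes q: "norm q < 1" and x: "\<And>m. x * q ^ m \<noteq> 1"
  obtains K where "K > 0" "\<And>k. norm (inverse (qpoch x q k)) \<le> K"
proof -
  have "summable (\<lambda>j. norm (- (x * q ^ j)))"
    using q by (simp add: norm_mult norm_power summable_mult summable_geometric)
  then have "abs_convergent_prod (\<lambda>j. 1 + - (x * q ^ j))"
    by (simp add: abs_convergent_prod_conv_summable)
  then have conv: "convergent_prod (\<lambda>j. 1 - x * q ^ j)"
    using abs_convergent_prod_imp_convergent_prod by force
  have "(\<lambda>m. \<Prod>j\<le>m. 1 - x * q ^ j) \<longlonglongrightarrow> (\<Prod>j. 1 - x * q ^ j)"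
    by (rule convergent_prod_LIMSEQ [OF conv])
  then have "(\<lambda>m. qpoch x q (Suc m)) \<longlonglongrightarrow> (\<Prod>j. 1 - x * q ^ j)"
    by (simp add: qpoch_def lessThan_Suc_atMost)
  then have "(\<lambda>m. qpoch x q m) \<longlonglongrightarrow> (\<Prod>j. 1 - x * q ^ j)"
    by (simp add: filterlim_sequentially_Suc)
  moreover have "(\<Prod>j. 1 - x * q ^ j) \<noteq> 0"
    using prodinf_nonzero [OF conv] x by simp
  ultimately have "convergent (\<lambda>m. inverse (qpoch x q m))"
    using convergentI tendsto_inverse by metis
  then have "Bseq (\<lambda>m. inverse (qpoch x q m))"
    by (rule convergent_imp_Bseq)
  then show thesis
    using that by (auto elim: BseqE)
qed

text \<open>Uniformity in n comes from writing the shifted symbol as the quotient (x;q)_(n+k) /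
  (x;q)_n: its inverse is a bounded symbol times a bounded reciprocal.\<close>

lemma inverse_qpoch_shift_bounded:
  assumes q: "norm q < 1" and x: "\<And>m. x * q ^ m \<noteq> 1"
  obtains K where "K > 0" "\<And>n k. norm (inverse (qpoch (x * q ^ n) q k)) \<le> K"
proof -
  obtain L where L: "L > 0" "\<And>k. norm (inverse (qpoch x q k)) \<le> L"
    using inverse_qpoch_bounded [OF assms] by blast
  define M where "M = exp (norm x / (1 - norm q))"
  have "norm (inverse (qpoch (x * q ^ n) q k)) \<le> M * L" for n k
  proof -
    have "inverse (qpoch (x * q ^ n) q k) = qpoch x q n * inverse (qpoch x q (n + k))"
      using qpoch_nonzero [OF x] by (simp add: qpoch_add)
    then show ?thesis
      using norm_qpoch_le [OF q order_refl, of x n] L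
      by (simp add: norm_mult M_def mult_mono)
  qed
  moreover have "M * L > 0"
    using L by (simp add: M_def)
  ultimately show thesis
    using that by blast
qed

section \<open>Two recurrences for the defining series\<close>

text \<open>These conditions survive both parameter shifts when q is nonzero, so every result below
  can be reused at the shifted parameters. The regularity conditions keep the denominators of the
  defining series nonzero. The bound on d makes its geometric ratio less than 1 and keeps b + d away
  from zero.\<close>

locale rho_params =
  fixes q a b c d :: complex
  assumes q_less_1: "norm q < 1"
    and a_regular: "\<And>m. (- a * q) * q ^ m \<noteq> 1"
    and c_regular: "\<And>m. (- c / b) * q ^ m \<noteq> 1"
    and d_nonzero: "d \<noteq> 0"
    and d_less_b: "norm d < norm b"
begin

lemma b_nonzero: "b \<noteq> 0"
  using d_less_b by auto

lemma b_plus_d: "b + d \<noteq> 0"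
  using d_less_b by (metis add_eq_0_iff less_irrefl norm_minus_cancel)

lemma one_plus_aq: "1 + a * q * q ^ m \<noteq> 0"
  using a_regular [of m] by (auto simp: add_eq_0_iff)

lemma one_plus_c_over_b: "1 + c / b * q ^ m \<noteq> 0"
  using c_regular [of m] by (auto simp: add_eq_0_iff)

lemma q_power_tendsto_0: "(\<lambda>n. q ^ n) \<longlonglongrightarrow> 0"
  using q_less_1 by (rule LIMSEQ_power_zero)

section \<open>Bounds uniform in the parameter shift\<close>

lemma quotient_bounded:
  "\<exists>K>0. \<forall>x y n k. norm x \<le> X \<longrightarrow> norm y \<le> Y \<longrightarrow>
       norm (qpoch x q k * qpoch y q k /
         (qpoch (- a * q * q ^ n) q k * qpoch (- c / b * q ^ n) q (k + 1))) \<le> K"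
proof -
  obtain A where A: "A > 0" "\<And>n k. norm (inverse (qpoch (- a * q * q ^ n) q k)) \<le> A"
    using inverse_qpoch_shift_bounded [OF q_less_1 a_regular] by blast
  obtain C where C: "C > 0" "\<And>n k. norm (inverse (qpoch (- c / b * q ^ n) q k)) \<le> C"
    using inverse_qpoch_shift_bounded [OF q_less_1 c_regular] by blast
  define P where "P Z = exp (Z / (1 - norm q))" for Z
  show ?thesis
  proof (intro exI conjI allI impI)
    show "P X * P Y * (A * C) > 0"
      using A C by (simp add: P_def)
    fix x y :: complex and n k :: nat
    assume x: "norm x \<le> X" and y: "norm y \<le> Y"
    have "norm (qpoch x q k * qpoch y q k *
        (inverse (qpoch (- a * q * q ^ n) q k) * inverse (qpoch (- c / b * q ^ n) q (k + 1))))
      \<le> P X * P Y * (A * C)"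
      unfolding norm_mult P_def
      by (intro mult_mono norm_qpoch_le q_less_1 x y A C mult_nonneg_nonneg norm_ge_zero)
         (use A C in auto)
    then show "norm (qpoch x q k * qpoch y q k /
        (qpoch (- a * q * q ^ n) q k * qpoch (- c / b * q ^ n) q (k + 1))) \<le> P X * P Y * (A * C)"
      by (simp add: divide_inverse)
  qed
qed

lemma ratio_less_1: "norm (d / b) < 1"
  using d_less_b b_nonzero by (simp add: norm_divide)

text \<open>A common form for the terms of both n-fold shifted series: their denominators agree, and
  only the two numerator parameters and the ratio differ.\<close>

definition gen_term :: "complex \<Rightarrow> complex \<Rightarrow> complex \<Rightarrow> nat \<Rightarrow> nat \<Rightarrow> complex" where
  "gen_term x y z n k = qpoch x q k * qpoch y q k /
     (qpoch (- a * q * q ^ n) q k * qpoch (- c / b * q ^ n) q (k + 1)) * z ^ k"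

text \<open>A geometric series with ratio |d/b| dominates all these series simultaneously, hence one
  K for all x, y, z and n.\<close>

lemma series_bounded:
  "\<exists>K. \<forall>x y z n. norm x \<le> X \<longrightarrow> norm y \<le> Y \<longrightarrow> norm z \<le> norm (d / b) \<longrightarrow>
       summable (gen_term x y z n) \<and> norm (\<Sum>k. gen_term x y z n k) \<le> K"
proof -
  obtain K where K: "K > 0" "\<And>x y n k. norm x \<le> X \<Longrightarrow> norm y \<le> Y \<Longrightarrow>
       norm (qpoch x q k * qpoch y q k /
         (qpoch (- a * q * q ^ n) q k * qpoch (- c / b * q ^ n) q (k + 1))) \<le> K"
    using quotient_bounded [of X Y] by metis
  show ?thesis
  proof (intro exI allI impI)
    fix x y z :: complex and n :: nat
    assume xyz: "norm x \<le> X" "norm y \<le> Y" "norm z \<le> norm (d / b)"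
    let ?g = "\<lambda>k. K * norm (d / b) ^ k"
    have g: "summable ?g"
      using ratio_less_1 by (intro summable_mult summable_geometric) simp
    have le: "norm (gen_term x y z n k) \<le> ?g k" for k
    proof -
      have "norm (z ^ k) \<le> norm (d / b) ^ k"
        unfolding norm_power using xyz(3) by (intro power_mono norm_ge_zero)
      then show ?thesis
        using K(1) K(2) [OF xyz(1,2)]
        unfolding gen_term_def by (subst norm_mult) (intro mult_mono, auto)
    qed
    show "summable (gen_term x y z n) \<and> norm (\<Sum>k. gen_term x y z n k) \<le> (\<Sum>k. ?g k)"
      by (intro conjI summable_comparison_test' [OF g le] norm_suminf_le le g)
  qed
qed

lemma summable_rho_term: "summable (rho_term q a b c d)"
proof -
  obtain K where
    "\<And>x y z n. norm x \<le> norm c \<Longrightarrow> norm y \<le> norm (- a * q / d) \<Longrightarrow> norm z \<le> norm (d / b) \<Longrightarrow>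
       summable (gen_term x y z n) \<and> norm (\<Sum>k. gen_term x y z n k) \<le> K"
    using series_bounded [of "norm c" "norm (- a * q / d)"] by metis
  from this [of c "- a * q / d" "- d / b" 0] show ?thesis
    unfolding rho_term_def gen_term_def by simp
qed

text \<open>The boundary term at infinity vanishes: r converges, being affine in q^k, and the terms
  of a summable series tend to 0. Only k = 0 contributes, where the term is 1/(1 + c/b) because the
  second denominator symbol already has length one.\<close>

lemma rho_term_telescope:
  assumes r: "\<And>k. r k = \<alpha> + \<beta> * q ^ k"
    and step: "\<And>k. r (Suc k) * rho_term q a b c d (Suc k) - r k * rho_term q a b c d k
                 = rho_term q a b c d k - C * t k"
    and t: "summable t"
  shows "(\<Sum>k. rho_term q a b c d k) = - r 0 / (1 + c / b) + C * (\<Sum>k. t k)"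
proof -
  have "r \<longlonglongrightarrow> \<alpha> + \<beta> * 0"
    unfolding r by (intro tendsto_intros q_power_tendsto_0)
  then have "(\<lambda>k. r k * rho_term q a b c d k) \<longlonglongrightarrow> (\<alpha> + \<beta> * 0) * 0"
    by (intro tendsto_mult summable_LIMSEQ_zero summable_rho_term)
  then have "(\<lambda>k. rho_term q a b c d k - C * t k) sums
      ((\<alpha> + \<beta> * 0) * 0 - r 0 * rho_term q a b c d 0)"
    unfolding step [symmetric] by (rule telescope_sums)
  moreover have "(\<lambda>k. rho_term q a b c d k - C * t k) sums
      ((\<Sum>k. rho_term q a b c d k) - C * (\<Sum>k. t k))"
    by (intro sums_diff sums_mult summable_sums summable_rho_term t)
  ultimately have "(\<Sum>k. rho_term q a b c d k) - C * (\<Sum>k. t k) = - r 0 * rho_term q a b c d 0"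
    using sums_unique2 by fastforce
  moreover have "rho_term q a b c d 0 = 1 / (1 + c / b)"
    by (simp add: rho_term_def qpoch_Suc)
  ultimately show ?thesis
    by (simp add: algebra_simps)
qed

text \<open>
  The common factor of \<open>t\<^sub>k\<close>, \<open>t\<^sub>k\<^sub>+\<^sub>1\<close> and the shifted terms; the remaining factors are
  polynomials in \<open>q\<^sup>k\<close>.
\<close>

definition core :: "nat \<Rightarrow> complex" where
  "core k = qpoch c q k * qpoch (- a * q / d) q k * (- d / b) ^ k /
     (qpoch (- a * q) q (Suc k) * qpoch (- c / b) q (Suc (Suc k)))"

lemma rho_term_core:
  "rho_term q a b c d k = core k * (1 + a * q * q ^ k) * (1 + c / b * (q * q ^ k))"
  using one_plus_aq [of k] one_plus_c_over_b [of "Suc k"]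
  by (simp add: rho_term_def core_def qpoch_Suc [of "- (a * q)"] qpoch_Suc [of _ _ "Suc k"])

lemma rho_term_Suc_core:
  "rho_term q a b c d (Suc k) = core k * (1 - c * q ^ k) * (1 + a * q / d * q ^ k) * (- d / b)"
  by (simp add: rho_term_def core_def qpoch_Suc [of c] qpoch_Suc [of "- (a * q / d)"] mult_ac)

section \<open>Terms of the shifted series over the common factor\<close>

lemma denominator_shift:
  "(1 + a * q) * qpoch (- a * q * q) q k = qpoch (- a * q) q (Suc k)"
  "(1 + c / b) * qpoch (- c / b * q) q (Suc k) = qpoch (- c / b) q (Suc (Suc k))"
  using qpoch_shift [of "- a * q" q k] qpoch_shift [of "- c / b" q "Suc k"]
  by (simp_all add: qpoch_Suc [of "- (a * q)"] qpoch_Suc [of _ _ "Suc k"])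

text \<open>The prefactor supplies the missing first factors of the shifted symbols, so that
  \<open>qpoch_shift\<close> and \<open>denominator_shift\<close> apply. The power q^k comes from
  replacing b by b/q in the ratio -d/b.\<close>

lemma rho_term_shift_ab:
  "(1 + a * q / d) / ((1 + a * q) * (1 + c / b)) * rho_term q (a * q) (b / q) c d k
    = core k * (1 + a * q / d * q ^ k) * q ^ k"
proof -
  have num: "(1 + a * q / d) * qpoch (- (a * q * q) / d) q k
      = qpoch (- a * q / d) q k * (1 + a * q / d * q ^ k)"
    using qpoch_shift [of "- a * q / d" q k] by (simp add: mult_ac)
  have eq: "- c / (b / q) = - c / b * q" "(- d / (b / q)) ^ k = (- d / b) ^ k * q ^ k"
    by (simp_all add: power_mult_distrib [symmetric])
  have "(1 + a * q / d) / ((1 + a * q) * (1 + c / b)) * rho_term q (a * q) (b / q) c d k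
      = qpoch c q k * ((1 + a * q / d) * qpoch (- (a * q * q) / d) q k) /
        (((1 + a * q) * qpoch (- a * q * q) q k) * ((1 + c / b) * qpoch (- c / b * q) q (Suc k)))
        * ((- d / b) ^ k * q ^ k)"
    unfolding rho_term_def eq by (simp add: mult_ac)
  also have "\<dots> = core k * (1 + a * q / d * q ^ k) * q ^ k"
    unfolding num denominator_shift core_def by (simp add: mult_ac)
  finally show ?thesis .
qed

text \<open>Here a and d scale alike, so the symbol with parameter -aq/d is unchanged and the symbol
  of c is the one to be completed. The power q^k now comes from replacing d by dq.\<close>

lemma rho_term_shift_acd:
  assumes "q \<noteq> 0"
  shows "(1 - c) / ((1 + a * q) * (1 + c / b)) * rho_term q (a * q) b (c * q) (d * q) k
    = core k * (1 - c * q ^ k) * q ^ k"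
proof -
  have eq: "- (c * q) / b = - c / b * q" "(- (d * q) / b) ^ k = (- d / b) ^ k * q ^ k"
    "- (a * q) * q / (d * q) = - a * q / d"
    using assms by (simp_all add: power_mult_distrib [symmetric])
  have "(1 - c) / ((1 + a * q) * (1 + c / b)) * rho_term q (a * q) b (c * q) (d * q) k
      = ((1 - c) * qpoch (c * q) q k) * qpoch (- a * q / d) q k /
        (((1 + a * q) * qpoch (- a * q * q) q k) * ((1 + c / b) * qpoch (- c / b * q) q (Suc k)))
        * ((- d / b) ^ k * q ^ k)"
    unfolding rho_term_def eq by (simp add: mult_ac)
  also have "\<dots> = core k * (1 - c * q ^ k) * q ^ k"
    unfolding qpoch_shift denominator_shift core_def by (simp add: mult_ac)
  finally show ?thesis .
qed

section \<open>Admissibility of the shifts, and the two recurrences\<close>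

lemma shift_ab: "q \<noteq> 0 \<Longrightarrow> rho_params q (a * q ^ n) (b / q ^ n) c d"
proof
  assume q: "q \<noteq> 0"
  show "- (a * q ^ n) * q * q ^ m \<noteq> 1" for m
    using a_regular [of "n + m"] by (simp add: power_add mult_ac)
  show "- c / (b / q ^ n) * q ^ m \<noteq> 1" for m
    using c_regular [of "n + m"] by (simp add: power_add mult_ac)
  have "norm d * norm q ^ n \<le> norm d * 1"
    using q_less_1 by (intro mult_left_mono power_le_one) auto
  then show "norm d < norm (b / q ^ n)"
    using d_less_b q by (simp add: norm_divide norm_power field_simps)
qed (use q_less_1 d_nonzero in auto)

lemma shift_acd: "q \<noteq> 0 \<Longrightarrow> rho_params q (a * q ^ n) b (c * q ^ n) (d * q ^ n)"
proof
  assume q: "q \<noteq> 0"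
  show "- (a * q ^ n) * q * q ^ m \<noteq> 1" for m
    using a_regular [of "n + m"] by (simp add: power_add mult_ac)
  show "- (c * q ^ n) / b * q ^ m \<noteq> 1" for m
    using c_regular [of "n + m"] by (simp add: power_add mult_ac)
  have "norm d * norm q ^ n \<le> norm d * 1"
    using q_less_1 by (intro mult_left_mono power_le_one) auto
  then show "norm (d * q ^ n) < norm b"
    using d_less_b q by (simp add: norm_mult norm_power)
qed (use q_less_1 d_nonzero in auto)

lemma recurrence_ab:
  assumes q: "q \<noteq> 0"
  shows "(\<Sum>k. rho_term q a b c d k) = (1 - a * q / b) / ((1 + c / b) * (1 + d / b)) +
    (c + a * q) * (d + a * q) / b * (1 + q / b) / ((1 + a * q) * (1 + c / b) * (1 + d / b)) *
    (\<Sum>k. rho_term q (a * q) (b / q) c d k)"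
proof -
  interpret s: rho_params q "a * q" "b / q" c d
    using shift_ab [OF q, of 1] by simp
  \<comment> \<open>With u = q^k, this choice gives r + 1 = d (1 + aqu/d) / (b + d), which shares
    the factor 1 + aqu/d with the next term. The constant -b/(b + d) makes the combination vanish at
    u = 0.\<close>
  define r where "r k = - b / (b + d) + a * q / (b + d) * q ^ k" for k
  define C where "C = (c + a * q) * (d + a * q) / b * (1 + q / b) /
    ((1 + a * q) * (1 + c / b) * (1 + d / b))"
  have nz: "b \<noteq> 0" "d \<noteq> 0" "b + d \<noteq> 0" "1 + d / b \<noteq> 0"
    using b_nonzero d_nonzero b_plus_d by (auto simp: field_simps)
  have "(\<Sum>k. rho_term q a b c d k) = - r 0 / (1 + c / b) + C * (\<Sum>k. rho_term q (a * q) (b / q) c d k)"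
  proof (rule rho_term_telescope [OF r_def])
    fix k
    define w u where "w = core k" and "u = q ^ k"
    have d_factor: "d + a * q = d * (1 + a * q / d)"
      using nz by (simp add: field_simps)
    have "C * rho_term q (a * q) (b / q) c d k =
      (c + a * q) * d / b * (1 + q / b) / (1 + d / b) *
      ((1 + a * q / d) / ((1 + a * q) * (1 + c / b)) * rho_term q (a * q) (b / q) c d k)"
      unfolding C_def d_factor by (simp add: mult_ac)
    then have shifted: "C * rho_term q (a * q) (b / q) c d k =
      (c + a * q) * d / b * (1 + q / b) / (1 + d / b) * (w * (1 + a * q / d * u) * u)"
      unfolding rho_term_shift_ab w_def u_def .
    \<comment> \<open>After removing w and 1 + aqu/d, the difference of the first side and the
      unshifted term is a quadratic in u. Its constant and quadratic coefficients cancel; the linear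
      one contains (c + aq)(1 + q/b).\<close>
    have "(- b / (b + d) + a * q / (b + d) * (q * u)) *
        (w * (1 - c * u) * (1 + a * q / d * u) * (- d / b)) -
        (- b / (b + d) + a * q / (b + d) * u) * (w * (1 + a * q * u) * (1 + c / b * (q * u)))
      = w * (1 + a * q * u) * (1 + c / b * (q * u)) -
        (c + a * q) * d / b * (1 + q / b) / (1 + d / b) * (w * (1 + a * q / d * u) * u)"
      using nz by (simp add: divide_simps) algebra
    then show "r (Suc k) * rho_term q a b c d (Suc k) - r k * rho_term q a b c d k
        = rho_term q a b c d k - C * rho_term q (a * q) (b / q) c d k"
      unfolding shifted unfolding r_def rho_term_Suc_core unfolding rho_term_core w_def u_def by simp
  qed (rule s.summable_rho_term)
  moreover have "- r 0 = (1 - a * q / b) / (1 + d / b)"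
    using nz by (simp add: r_def divide_simps)
  ultimately show ?thesis
    by (simp add: C_def mult.commute)
qed

lemma recurrence_acd:
  assumes q: "q \<noteq> 0" and a: "a \<noteq> 0"
  shows "(\<Sum>k. rho_term q a b c d k) = (1 + c * d / b) / ((1 + c / b) * (1 + d / b)) +
    (- (q * (a / b) * (1 - c) * (1 - d) * (1 - c * d / (a * b))
       / ((1 + a * q) * (1 + c / b) * (1 + d / b)))) *
    (\<Sum>k. rho_term q (a * q) b (c * q) (d * q) k)"
proof -
  interpret s: rho_params q "a * q" b "c * q" "d * q"
    using shift_acd [OF q, of 1] by simp
  \<comment> \<open>Now r + 1 = d (1 - cu) / (b + d), so the factor shared with the next term is 1 -
    cu. The value at u = 0 is the same as for the other recurrence.\<close>
  define r where "r k = - b / (b + d) + - c * d / (b + d) * q ^ k" for k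
  define C where "C = - (q * (a / b) * (1 - c) * (1 - d) * (1 - c * d / (a * b))
       / ((1 + a * q) * (1 + c / b) * (1 + d / b)))"
  have nz: "b \<noteq> 0" "d \<noteq> 0" "b + d \<noteq> 0" "1 + d / b \<noteq> 0"
    using b_nonzero d_nonzero b_plus_d by (auto simp: field_simps)
  have "(\<Sum>k. rho_term q a b c d k) =
      - r 0 / (1 + c / b) + C * (\<Sum>k. rho_term q (a * q) b (c * q) (d * q) k)"
  proof (rule rho_term_telescope [OF r_def])
    fix k
    define w u where "w = core k" and "u = q ^ k"
    have "C * rho_term q (a * q) b (c * q) (d * q) k =
      - (q * (a / b) * (1 - d) * (1 - c * d / (a * b)) / (1 + d / b)) *
      ((1 - c) / ((1 + a * q) * (1 + c / b)) * rho_term q (a * q) b (c * q) (d * q) k)"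
      unfolding C_def by (simp add: mult_ac)
    then have shifted: "C * rho_term q (a * q) b (c * q) (d * q) k =
      - (q * (a / b) * (1 - d) * (1 - c * d / (a * b)) / (1 + d / b)) * (w * (1 - c * u) * u)"
      unfolding rho_term_shift_acd [OF q] w_def u_def .
    \<comment> \<open>After removing w and 1 - cu, again only a linear term in u survives. Its
      coefficient is proportional to q (1 - d)(a/d - c/b), which yields the factor 1 - cd/(ab)
      because a is nonzero.\<close>
    have "(- b / (b + d) + - c * d / (b + d) * (q * u)) *
        (w * (1 - c * u) * (1 + a * q / d * u) * (- d / b)) -
        (- b / (b + d) + - c * d / (b + d) * u) * (w * (1 + a * q * u) * (1 + c / b * (q * u)))
      = w * (1 + a * q * u) * (1 + c / b * (q * u)) -
        (- (q * (a / b) * (1 - d) * (1 - c * d / (a * b)) / (1 + d / b)) * (w * (1 - c * u) * u))"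
      using nz a by (simp add: divide_simps) algebra
    then show "r (Suc k) * rho_term q a b c d (Suc k) - r k * rho_term q a b c d k
        = rho_term q a b c d k - C * rho_term q (a * q) b (c * q) (d * q) k"
      unfolding shifted unfolding r_def rho_term_Suc_core unfolding rho_term_core w_def u_def by simp
  qed (rule s.summable_rho_term)
  moreover have "- r 0 = (1 + c * d / b) / (1 + d / b)"
    using nz by (simp add: r_def divide_simps)
  ultimately show ?thesis
    by (simp add: C_def mult.commute)
qed

text \<open>The parameter -aq/d and the ratio -d/b are both multiplied by q^n, so their norms never
  exceed the values at n = 0 and \<open>series_bounded\<close> gives one constant.\<close>

lemma sum_shift_ab_bounded:
  obtains K where "\<And>n. norm (\<Sum>k. rho_term q (a * q ^ n) (b / q ^ n) c d k) \<le> K"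
proof -
  obtain K where K:
    "\<And>x y z n. norm x \<le> norm c \<Longrightarrow> norm y \<le> norm (- a * q / d) \<Longrightarrow> norm z \<le> norm (d / b) \<Longrightarrow>
       summable (gen_term x y z n) \<and> norm (\<Sum>k. gen_term x y z n k) \<le> K"
    using series_bounded [of "norm c" "norm (- a * q / d)"] by metis
  have "norm (\<Sum>k. rho_term q (a * q ^ n) (b / q ^ n) c d k) \<le> K" for n
  proof -
    have eq: "- (a * q ^ n) * q = - a * q * q ^ n" "- c / (b / q ^ n) = - c / b * q ^ n"
      "- d / (b / q ^ n) = - d / b * q ^ n"
      by simp_all
    have "norm q ^ n \<le> 1"
      using q_less_1 by (simp add: power_le_one)
    then have "norm (w * q ^ n) \<le> norm w" for w
      by (simp add: norm_mult norm_power mult_left_le)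
    from this [of "- a * q / d"] this [of "- d / b"] show ?thesis
      using K [of c "- a * q * q ^ n / d" "- d / b * q ^ n" n]
      unfolding rho_term_def gen_term_def eq by simp
  qed
  then show thesis
    by (rule that)
qed

text \<open>Here c and -d/b shrink by q^n while -aq/d stays fixed; the same bounds at n = 0
  suffice.\<close>

lemma sum_shift_acd_bounded:
  assumes "q \<noteq> 0"
  obtains K where "\<And>n. norm (\<Sum>k. rho_term q (a * q ^ n) b (c * q ^ n) (d * q ^ n) k) \<le> K"
proof -
  obtain K where K:
    "\<And>x y z n. norm x \<le> norm c \<Longrightarrow> norm y \<le> norm (- a * q / d) \<Longrightarrow> norm z \<le> norm (d / b) \<Longrightarrow>
       summable (gen_term x y z n) \<and> norm (\<Sum>k. gen_term x y z n k) \<le> K"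
    using series_bounded [of "norm c" "norm (- a * q / d)"] by metis
  have "norm (\<Sum>k. rho_term q (a * q ^ n) b (c * q ^ n) (d * q ^ n) k) \<le> K" for n
  proof -
    have eq: "- (a * q ^ n) * q / (d * q ^ n) = - a * q / d"
      "- (a * q ^ n) * q = - a * q * q ^ n" "- (c * q ^ n) / b = - c / b * q ^ n"
      "- (d * q ^ n) / b = - d / b * q ^ n"
      using assms by simp_all
    have "norm q ^ n \<le> 1"
      using q_less_1 by (simp add: power_le_one)
    then have "norm (w * q ^ n) \<le> norm w" for w
      by (simp add: norm_mult norm_power mult_left_le)
    from this [of c] this [of "- d / b"] show ?thesis
      using K [of "c * q ^ n" "- a * q / d" "- d / b * q ^ n" n]
      unfolding rho_term_def gen_term_def eq by (simp add: assms)
  qed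
  then show thesis
    by (rule that)
qed

end

section \<open>Iterating the recurrences\<close>

text \<open>W n is the product of the first n coefficients, so n iterations leave the remainder W n
  * R n. Since F tends to 0, the ratio test makes W summable, hence null; boundedness of R then
  kills the remainder.\<close>

lemma iterate_recurrence_sums:
  fixes R A F W :: "nat \<Rightarrow> complex"
  assumes rec: "\<And>n. R n = A n + F n * R (Suc n)"
    and W: "W 0 = 1" "\<And>n. W (Suc n) = F n * W n"
    and F: "F \<longlonglongrightarrow> 0"
    and R: "\<And>n. norm (R n) \<le> K"
  shows "(\<lambda>n. W n * A n) sums R 0"
proof -
  have partial: "(\<Sum>k<n. W k * A k) = R 0 - W n * R n" for n
  proof (induction n)
    case (Suc n)
    then show ?case
      using rec [of n] by (simp add: W algebra_simps)
  qed (simp add: W)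
  have "\<forall>\<^sub>F n in sequentially. norm (F n) < 1 / 2"
    using tendstoD [OF F, of "1 / 2"] by simp
  then obtain N where N: "\<And>n. n \<ge> N \<Longrightarrow> norm (F n) < 1 / 2"
    by (auto simp: eventually_sequentially)
  have "summable W"
  proof (rule summable_ratio_test)
    show "norm (W (Suc n)) \<le> 1 / 2 * norm (W n)" if "n \<ge> N" for n
      unfolding W norm_mult using N [OF that] by (intro mult_right_mono) auto
  qed simp
  then have "(\<lambda>n. norm (W n) * K) \<longlonglongrightarrow> 0 * K"
    by (intro tendsto_mult tendsto_norm_zero summable_LIMSEQ_zero tendsto_const)
  then have "(\<lambda>n. W n * R n) \<longlonglongrightarrow> 0"
    by (intro Lim_null_comparison [of "\<lambda>n. W n * R n"])
       (auto simp: norm_mult R intro!: always_eventually mult_left_mono)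
  then have "(\<lambda>n. R 0 - W n * R n) \<longlonglongrightarrow> R 0 - 0"
    by (intro tendsto_intros)
  then show ?thesis
    unfolding sums_def partial by simp
qed

lemma Suc_choose_2: "Suc n choose 2 = n + (n choose 2)"
  by (simp add: numeral_2_eq_2)

context rho_params
begin

lemma rho_term2_sums:
  assumes q: "q \<noteq> 0" and c: "c \<noteq> 0"
  shows "rho_term2 q a b c d sums rho q a b c d"
proof -
  define R where "R n = (\<Sum>k. rho_term q (a * q ^ n) (b / q ^ n) c d k)" for n
  define A where "A n = (1 - a * q ^ (2 * n + 1) / b) / ((1 + c / b * q ^ n) * (1 + d / b * q ^ n))"
    for n
  define F where "F n = (c + a * q * q ^ n) * (d + a * q * q ^ n) / b * q ^ n * (1 + q / b * q ^ n) /
    ((1 + a * q * q ^ n) * (1 + c / b * q ^ n) * (1 + d / b * q ^ n))" for n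
  \<comment> \<open>Closed form of the product of F 0, ..., F (n - 1). The factors q^n in F
    accumulate to the power with exponent n choose 2.\<close>
  define W where "W n = q ^ (n choose 2) * (qpoch (- q / b) q n *
    qpoch (- a * q / c) q n * qpoch (- a * q / d) q n /
    (qpoch (- a * q) q n * qpoch (- c / b) q n * qpoch (- d / b) q n)) * (c * d / b) ^ n" for n
  obtain K where K: "\<And>n. norm (R n) \<le> K"
    using sum_shift_ab_bounded unfolding R_def by blast
  have "(\<lambda>n. W n * A n) sums R 0"
  proof (rule iterate_recurrence_sums [OF _ _ _ _ K])
    fix n
    interpret s: rho_params q "a * q ^ n" "b / q ^ n" c d
      by (rule shift_ab [OF q])
    have "R n = (1 - a * q ^ n * q / (b / q ^ n)) / ((1 + c / (b / q ^ n)) * (1 + d / (b / q ^ n))) +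
      (c + a * q ^ n * q) * (d + a * q ^ n * q) / (b / q ^ n) * (1 + q / (b / q ^ n)) /
      ((1 + a * q ^ n * q) * (1 + c / (b / q ^ n)) * (1 + d / (b / q ^ n))) *
      (\<Sum>k. rho_term q (a * q ^ n * q) (b / q ^ n / q) c d k)"
      unfolding R_def by (rule s.recurrence_ab [OF q])
    also have "\<dots> = A n + F n * R (Suc n)"
      by (simp add: A_def F_def R_def mult_ac mult_2_right power_add)
    finally show "R n = A n + F n * R (Suc n)" .
    \<comment> \<open>Pulling out c and d produces the symbols with parameters -aq/c and -aq/d,
      together with the power of cd/b; this requires c to be nonzero.\<close>
    have "c + a * q * q ^ n = c * (1 + a * q / c * q ^ n)"
      "d + a * q * q ^ n = d * (1 + a * q / d * q ^ n)"
      using c d_nonzero by (simp_all add: field_simps)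
    then show "W (Suc n) = F n * W n"
      by (simp add: W_def F_def qpoch_Suc Suc_choose_2 power_add mult_ac)
  next
    show "F \<longlonglongrightarrow> 0"
      unfolding F_def by (auto intro!: tendsto_eq_intros simp: b_nonzero q_less_1)
  qed (simp add: W_def numeral_2_eq_2)
  then have "(\<lambda>n. (1 + 1 / b) * (W n * A n)) sums ((1 + 1 / b) * R 0)"
    by (rule sums_mult)
  moreover have "(1 + 1 / b) * (W n * A n) = rho_term2 q a b c d n" for n
  proof -
    \<comment> \<open>Iteration only produces the factors 1 + q^j/b with j >= 1; the prefactor of
      \<open>rho\<close> supplies the one with j = 0.\<close>
    have first_factor: "(1 + 1 / b) * qpoch (- q / b) q n = qpoch (- 1 / b) q (n + 1)"
      using qpoch_shift [of "- 1 / b" q n] by (simp add: qpoch_Suc)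
    show ?thesis
      unfolding rho_term2_def first_factor [symmetric]
      by (simp add: W_def A_def qpoch_Suc [of "- (c / b)"] qpoch_Suc [of "- (d / b)"] mult_ac)
  qed
  ultimately show ?thesis
    by (simp add: rho_def R_def)
qed

lemma rho_term3_sums:
  assumes q: "q \<noteq> 0" and a: "a \<noteq> 0"
  shows "rho_term3 q a b c d sums (\<Sum>k. rho_term q a b c d k)"
proof -
  define R where "R n = (\<Sum>k. rho_term q (a * q ^ n) b (c * q ^ n) (d * q ^ n) k)" for n
  define A where "A n = (1 + c * d * q ^ (2 * n) / b) / ((1 + c / b * q ^ n) * (1 + d / b * q ^ n))"
    for n
  define F where "F n = - (q * (a / b) * q ^ n * (1 - c * q ^ n) * (1 - d * q ^ n) *
    (1 - c * d / (a * b) * q ^ n) /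
    ((1 + a * q * q ^ n) * (1 + c / b * q ^ n) * (1 + d / b * q ^ n)))" for n
  \<comment> \<open>Each F n contributes -q^(n+1), whence the sign and the exponent (n + 1) choose
    2.\<close>
  define W where "W n = (- 1) ^ n * q ^ ((n + 1) choose 2) *
    (qpoch c q n * qpoch d q n * qpoch (c * d / (a * b)) q n /
    (qpoch (- a * q) q n * qpoch (- c / b) q n * qpoch (- d / b) q n)) * (a / b) ^ n" for n
  obtain K where K: "\<And>n. norm (R n) \<le> K"
    using sum_shift_acd_bounded [OF q] unfolding R_def by blast
  have "(\<lambda>n. W n * A n) sums R 0"
  proof (rule iterate_recurrence_sums [OF _ _ _ _ K])
    fix n
    interpret s: rho_params q "a * q ^ n" b "c * q ^ n" "d * q ^ n"
      by (rule shift_acd [OF q])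
    have "a * q ^ n \<noteq> 0"
      using a q by simp
    have "R n = (1 + c * q ^ n * (d * q ^ n) / b) / ((1 + c * q ^ n / b) * (1 + d * q ^ n / b)) +
      (- (q * (a * q ^ n / b) * (1 - c * q ^ n) * (1 - d * q ^ n) *
         (1 - c * q ^ n * (d * q ^ n) / (a * q ^ n * b)) /
        ((1 + a * q ^ n * q) * (1 + c * q ^ n / b) * (1 + d * q ^ n / b)))) *
      (\<Sum>k. rho_term q (a * q ^ n * q) b (c * q ^ n * q) (d * q ^ n * q) k)"
      unfolding R_def by (rule s.recurrence_acd [OF q \<open>a * q ^ n \<noteq> 0\<close>])
    \<comment> \<open>The numerator cd gains q^(2n) but ab only q^n, so this parameter moves by q^n
      and builds up a single symbol.\<close>
    also have "c * q ^ n * (d * q ^ n) / (a * q ^ n * b) = c * d / (a * b) * q ^ n"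
      using q by simp
    finally show "R n = A n + F n * R (Suc n)"
      by (simp add: A_def F_def R_def mult_ac mult_2_right power_add)
    show "W (Suc n) = F n * W n"
      by (simp add: W_def F_def qpoch_Suc Suc_choose_2 power_add mult_ac)
  next
    show "F \<longlonglongrightarrow> 0"
      unfolding F_def by (auto intro!: tendsto_eq_intros simp: a b_nonzero q_less_1)
  qed (simp add: W_def numeral_2_eq_2)
  moreover have "W n * A n = rho_term3 q a b c d n" for n
    unfolding rho_term3_def
    by (simp add: W_def A_def qpoch_Suc [of "- (c / b)"] qpoch_Suc [of "- (d / b)"] mult_ac)
  ultimately show ?thesis
    by (simp add: R_def)
qed

end

text \<open>The conditions c nonzero and a nonzero guard the quotients -aq/c and cd/(ab), which
  would otherwise take the default value 0. The condition \<open>a_poles\<close> keeps the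
  denominators (-aq;q)_k nonzero.\<close>

theorem theorem3p1:
  fixes q a b c d :: complex
  assumes q: "0 < norm q" "norm q < 1"
    and cd_a: "\<And>m::nat. c \<noteq> - a / q ^ m \<and> d \<noteq> - a / q ^ m"
    and cd_b: "\<And>n::nat. c \<noteq> - b / q ^ n \<and> d \<noteq> - b / q ^ n"
    and d: "0 < norm d" "norm d < norm b"
    and a_poles: "\<And>m::nat. - a * q \<noteq> 1 / q ^ m"
  shows "summable (rho_term q a b c d) \<and>
    (c \<noteq> 0 \<longrightarrow>
       summable (rho_term2 q a b c d) \<and>
       rho q a b c d = (\<Sum>k. rho_term2 q a b c d k)) \<and>
    (a \<noteq> 0 \<longrightarrow>
       summable (rho_term3 q a b c d) \<and>
       rho q a b c d = (1 + 1 / b) * (\<Sum>k. rho_term3 q a b c d k))"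
proof -
  have q0: "q \<noteq> 0" and b0: "b \<noteq> 0"
    using q d by auto
  interpret rho_params q a b c d
  proof
    show "- a * q * q ^ m \<noteq> 1" for m
      using a_poles [of m] q0 by (simp add: eq_divide_eq)
    show "- c / b * q ^ m \<noteq> 1" for m
    proof
      assume "- c / b * q ^ m = 1"
      then have "c = - b / q ^ m"
        using q0 b0 by (auto simp: field_simps)
      then show False
        using cd_b by blast
    qed
  qed (use q d in auto)
  show ?thesis
    using summable_rho_term rho_term2_sums [OF q0] rho_term3_sums [OF q0]
    by (auto simp: rho_def sums_iff)
qed

end
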